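(* The comparison atoms $\Pr(\alpha \mid \beta)\vartriangleleft \Pr(\gamma \mid \delta)$ and $\Pr(\alpha \mid \beta)\vartriangleleft \Pr(\gamma)$ (where $\vartriangleleft \in \{\leq,\geq,<,>,=\}$) are not, in general, expressible in $\mathcal{PCO}$.
   Context: Causal multiteams $T=(T^-,\mathcal F)$ of a finite signature consist of a finite multiset $T^-$ of assignments and a (recursive) function component $\mathcal F$ of structural equations. For a $\mathcal{CO}$ formula $\gamma$, $T^\gamma$ is the sub-multiteam of assignments satisfying $\gamma$, and $P_T(\alpha)$ is the proportion of assignments of $T^-$ satisfying $\alpha$. The conditional comparison atoms are interpreted by: $T\models\Pr(\alpha\mid\beta)\vartriangleleft\Pr(\gamma\mid\delta)$ iff $(T^\beta)^-=\emptyset$ or $(T^\delta)^-=\emptyset$ or $P_{T^\beta}(\alpha)\vartriangleleft P_{T^\delta}(\gamma)$; and $\Pr(\alpha\mid\beta)\vartriangleleft\Pr(\gamma)$ is the case $\delta=\top$. The language $\mathcal{PCO}$ is built from $\mathcal{CO}$ literals and unconditional probabilistic atoms $\Pr(\alpha)\geq\epsilon$, $\Pr(\alpha)>\epsilon$, $\Pr(\alpha)\geq\Pr(\beta)$, $\Pr(\alpha)>\Pr(\beta)$ ($\alpha,\beta\in\mathcal{CO}$, $\epsilon\in[0,1]\cap\mathbb Q$, true on empty multiteams), closed under $\land$, global disjunction $\sqcup$, selective implication $\alpha\supset\varphi$ and interventionist counterfactual $\mathbf X=\mathbf x\,\Box\!\!\rightarrow\varphi$. Expressibility means equivalence (same satisfying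 causal multiteams of the signature) with some $\mathcal{PCO}$ formula. *)

theory Defs
  imports Complex_Main "HOL-Library.Multiset" "HOL-Library.FuncSet"
begin
record ('v, 'a) signature =
  vars :: "'v set"
  rng :: "'v \<Rightarrow> 'a set"

definition is_signature :: "('v, 'a) signature \<Rightarrow> bool" where
  "is_signature \<sigma> \<longleftrightarrow> finite (vars \<sigma>) \<and> vars \<sigma> \<noteq> {} \<and>
     (\<forall>X\<in>vars \<sigma>. finite (rng \<sigma> X) \<and> rng \<sigma> X \<noteq> {})"

definition assignments :: "('v, 'a) signature \<Rightarrow> ('v \<Rightarrow> 'a) set" where
  "assignments \<sigma> = PiE (vars \<sigma>) (rng \<sigma>)"

definition other_assignments :: "('v, 'a) signature \<Rightarrow> 'v \<Rightarrow> ('v \<Rightarrow> 'a) set" where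
  "other_assignments \<sigma> V = PiE (vars \<sigma> - {V}) (rng \<sigma>)"

text \<open>A function component is a finite map \<open>F\<close>. Its domain is the set of endogenous variables;
  \<open>F V = Some f\<close> gives the structural equation \<open>V := f (W)\<close>, where \<open>W\<close> is the restriction of the
  assignment to all variables other than \<open>V\<close>.\<close>

type_synonym ('v, 'a) funcomp = "'v \<rightharpoonup> (('v \<Rightarrow> 'a) \<Rightarrow> 'a)"

type_synonym ('v, 'a) cmteam = "('v \<Rightarrow> 'a) multiset \<times> ('v, 'a) funcomp"

definition parents :: "('v, 'a) signature \<Rightarrow> 'v \<Rightarrow> (('v \<Rightarrow> 'a) \<Rightarrow> 'a) \<Rightarrow> 'v set" where
  "parents \<sigma> V f = {X \<in> vars \<sigma> - {V}.
     \<exists>w\<in>other_assignments \<sigma> V. \<exists>x\<in>rng \<sigma> X. f (w(X := x)) \<noteq> f w}"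

definition causal_graph :: "('v, 'a) signature \<Rightarrow> ('v, 'a) funcomp \<Rightarrow> ('v \<times> 'v) set" where
  "causal_graph \<sigma> F = {(X, V). \<exists>f. F V = Some f \<and> X \<in> parents \<sigma> V f}"

text \<open>Structural equations are required to be non-constant, as usual for causal (multi)teams.
  This only shrinks the class of models on which two formulas have to agree in order to be
  equivalent, so that it makes inexpressibility a stronger claim.\<close>

definition function_component :: "('v, 'a) signature \<Rightarrow> ('v, 'a) funcomp \<Rightarrow> bool" where
  "function_component \<sigma> F \<longleftrightarrow> dom F \<subseteq> vars \<sigma> \<and>
     (\<forall>V f. F V = Some f \<longrightarrow>
        f \<in> other_assignments \<sigma> V \<rightarrow>\<^sub>E rng \<sigma> V \<and>
        (\<exists>w\<in>other_assignments \<sigma> V. \<exists>w'\<in>other_assignments \<sigma> V. f w \<noteq> f w')) \<and>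
     acyclic (causal_graph \<sigma> F)"

definition compatible :: "('v, 'a) signature \<Rightarrow> ('v, 'a) funcomp \<Rightarrow> ('v \<Rightarrow> 'a) \<Rightarrow> bool" where
  "compatible \<sigma> F s \<longleftrightarrow> (\<forall>V f. F V = Some f \<longrightarrow> s V = f (restrict s (vars \<sigma> - {V})))"

definition causal_multiteam :: "('v, 'a) signature \<Rightarrow> ('v, 'a) cmteam \<Rightarrow> bool" where
  "causal_multiteam \<sigma> T \<longleftrightarrow>
     set_mset (fst T) \<subseteq> assignments \<sigma> \<and>
     function_component \<sigma> (snd T) \<and>
     (\<forall>s \<in># fst T. compatible \<sigma> (snd T) s)"

text \<open>An antecedent \<open>X\<^sub>1 = x\<^sub>1 \<and> \<dots> \<and> X\<^sub>n = x\<^sub>n\<close> is a list of variable-value pairs.\<close>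

type_synonym ('v, 'a) antecedent = "('v \<times> 'a) list"

definition antecedent_of :: "('v, 'a) signature \<Rightarrow> ('v, 'a) antecedent \<Rightarrow> bool" where
  "antecedent_of \<sigma> xs \<longleftrightarrow> (\<forall>(X, x) \<in> set xs. X \<in> vars \<sigma> \<and> x \<in> rng \<sigma> X)"

definition consistent :: "('v, 'a) antecedent \<Rightarrow> bool" where
  "consistent xs \<longleftrightarrow> (\<forall>X x y. (X, x) \<in> set xs \<longrightarrow> (X, y) \<in> set xs \<longrightarrow> x = y)"

definition is_do_solution ::
  "('v, 'a) signature \<Rightarrow> ('v, 'a) funcomp \<Rightarrow> ('v, 'a) antecedent \<Rightarrow>
   ('v \<Rightarrow> 'a) \<Rightarrow> ('v \<Rightarrow> 'a) \<Rightarrow> bool" where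
  "is_do_solution \<sigma> F xs s s' \<longleftrightarrow> s' \<in> assignments \<sigma> \<and>
     (\<forall>V\<in>vars \<sigma>. s' V =
        (case map_of xs V of
           Some x \<Rightarrow> x
         | None \<Rightarrow> (case F V of
               None \<Rightarrow> s V
             | Some f \<Rightarrow> f (restrict s' (vars \<sigma> - {V})))))"

text \<open>By recursiveness of \<open>F\<close> the solution exists and is unique, see \<open>do_solution_ex1\<close> below.\<close>

definition do_assignment ::
  "('v, 'a) signature \<Rightarrow> ('v, 'a) funcomp \<Rightarrow> ('v, 'a) antecedent \<Rightarrow> ('v \<Rightarrow> 'a) \<Rightarrow> ('v \<Rightarrow> 'a)" where
  "do_assignment \<sigma> F xs s = (THE s'. is_do_solution \<sigma> F xs s s')"

definition intervene ::
  "('v, 'a) signature \<Rightarrow> ('v, 'a) antecedent \<Rightarrow> ('v, 'a) cmteam \<Rightarrow> ('v, 'a) cmteam" where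
  "intervene \<sigma> xs T =
     (image_mset (do_assignment \<sigma> (snd T) xs) (fst T), snd T |` (- fst ` set xs))"

datatype ('v, 'a) co =
    CEq 'v 'a
  | CNeq 'v 'a
  | CAnd "('v, 'a) co" "('v, 'a) co"
  | COr "('v, 'a) co" "('v, 'a) co"
  | CSel "('v, 'a) co" "('v, 'a) co"
  | CCf "('v, 'a) antecedent" "('v, 'a) co"

primrec co_of :: "('v, 'a) signature \<Rightarrow> ('v, 'a) co \<Rightarrow> bool" where
  "co_of \<sigma> (CEq Y y) \<longleftrightarrow> Y \<in> vars \<sigma> \<and> y \<in> rng \<sigma> Y"
| "co_of \<sigma> (CNeq Y y) \<longleftrightarrow> Y \<in> vars \<sigma> \<and> y \<in> rng \<sigma> Y"
| "co_of \<sigma> (CAnd \<alpha> \<beta>) \<longleftrightarrow> co_of \<sigma> \<alpha> \<and> co_of \<sigma> \<beta>"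
| "co_of \<sigma> (COr \<alpha> \<beta>) \<longleftrightarrow> co_of \<sigma> \<alpha> \<and> co_of \<sigma> \<beta>"
| "co_of \<sigma> (CSel \<alpha> \<beta>) \<longleftrightarrow> co_of \<sigma> \<alpha> \<and> co_of \<sigma> \<beta>"
| "co_of \<sigma> (CCf xs \<alpha>) \<longleftrightarrow> antecedent_of \<sigma> xs \<and> co_of \<sigma> \<alpha>"

text \<open>In the clause for the (split) disjunction the two submultiteams have to cover the multiteam;
  they may overlap, and copies of the same assignment may be distributed between them.\<close>

primrec co_sat :: "('v, 'a) signature \<Rightarrow> ('v, 'a) cmteam \<Rightarrow> ('v, 'a) co \<Rightarrow> bool" where
  "co_sat \<sigma> T (CEq Y y) \<longleftrightarrow> (\<forall>s \<in># fst T. s Y = y)"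
| "co_sat \<sigma> T (CNeq Y y) \<longleftrightarrow> (\<forall>s \<in># fst T. s Y \<noteq> y)"
| "co_sat \<sigma> T (CAnd \<alpha> \<beta>) \<longleftrightarrow> co_sat \<sigma> T \<alpha> \<and> co_sat \<sigma> T \<beta>"
| "co_sat \<sigma> T (COr \<alpha> \<beta>) \<longleftrightarrow>
     (\<exists>A B. A \<subseteq># fst T \<and> B \<subseteq># fst T \<and> fst T \<subseteq># A + B \<and>
        co_sat \<sigma> (A, snd T) \<alpha> \<and> co_sat \<sigma> (B, snd T) \<beta>)"
| "co_sat \<sigma> T (CSel \<alpha> \<beta>) \<longleftrightarrow>
     co_sat \<sigma> ({#s \<in># fst T. co_sat \<sigma> ({#s#}, snd T) \<alpha>#}, snd T) \<beta>"
| "co_sat \<sigma> T (CCf xs \<alpha>) \<longleftrightarrow> (consistent xs \<longrightarrow> co_sat \<sigma> (intervene \<sigma> xs T) \<alpha>)"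

text \<open>\<open>observe \<sigma> T \<gamma>\<close> is \<open>T\<^sup>\<gamma>\<close>.\<close>

definition observe ::
  "('v, 'a) signature \<Rightarrow> ('v, 'a) cmteam \<Rightarrow> ('v, 'a) co \<Rightarrow> ('v, 'a) cmteam" where
  "observe \<sigma> T \<gamma> = ({#s \<in># fst T. co_sat \<sigma> ({#s#}, snd T) \<gamma>#}, snd T)"

definition Prob :: "('v, 'a) signature \<Rightarrow> ('v, 'a) cmteam \<Rightarrow> ('v, 'a) co \<Rightarrow> rat" where
  "Prob \<sigma> T \<alpha> = of_nat (size (fst (observe \<sigma> T \<alpha>))) / of_nat (size (fst T))"

text \<open>The constant \<open>\<top>\<close> abbreviates \<open>X = x \<or> X \<noteq> x\<close>; the choice of \<open>X\<close> and \<open>x\<close> is immaterial.\<close>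

definition co_top :: "('v, 'a) signature \<Rightarrow> ('v, 'a) co" where
  "co_top \<sigma> = (let X = (SOME X. X \<in> vars \<sigma>); x = (SOME x. x \<in> rng \<sigma> X)
     in COr (CEq X x) (CNeq X x))"

datatype ('v, 'a) pco =
    PEq 'v 'a
  | PNeq 'v 'a
  | PrGeConst "('v, 'a) co" rat
  | PrGtConst "('v, 'a) co" rat
  | PrGe "('v, 'a) co" "('v, 'a) co"
  | PrGt "('v, 'a) co" "('v, 'a) co"
  | PAnd "('v, 'a) pco" "('v, 'a) pco"
  | PGOr "('v, 'a) pco" "('v, 'a) pco"
  | PSel "('v, 'a) co" "('v, 'a) pco"
  | PCf "('v, 'a) antecedent" "('v, 'a) pco"

primrec pco_of :: "('v, 'a) signature \<Rightarrow> ('v, 'a) pco \<Rightarrow> bool" where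
  "pco_of \<sigma> (PEq Y y) \<longleftrightarrow> Y \<in> vars \<sigma> \<and> y \<in> rng \<sigma> Y"
| "pco_of \<sigma> (PNeq Y y) \<longleftrightarrow> Y \<in> vars \<sigma> \<and> y \<in> rng \<sigma> Y"
| "pco_of \<sigma> (PrGeConst \<alpha> \<epsilon>) \<longleftrightarrow> co_of \<sigma> \<alpha> \<and> 0 \<le> \<epsilon> \<and> \<epsilon> \<le> 1"
| "pco_of \<sigma> (PrGtConst \<alpha> \<epsilon>) \<longleftrightarrow> co_of \<sigma> \<alpha> \<and> 0 \<le> \<epsilon> \<and> \<epsilon> \<le> 1"
| "pco_of \<sigma> (PrGe \<alpha> \<beta>) \<longleftrightarrow> co_of \<sigma> \<alpha> \<and> co_of \<sigma> \<beta>"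
| "pco_of \<sigma> (PrGt \<alpha> \<beta>) \<longleftrightarrow> co_of \<sigma> \<alpha> \<and> co_of \<sigma> \<beta>"
| "pco_of \<sigma> (PAnd \<phi> \<psi>) \<longleftrightarrow> pco_of \<sigma> \<phi> \<and> pco_of \<sigma> \<psi>"
| "pco_of \<sigma> (PGOr \<phi> \<psi>) \<longleftrightarrow> pco_of \<sigma> \<phi> \<and> pco_of \<sigma> \<psi>"
| "pco_of \<sigma> (PSel \<alpha> \<phi>) \<longleftrightarrow> co_of \<sigma> \<alpha> \<and> pco_of \<sigma> \<phi>"
| "pco_of \<sigma> (PCf xs \<phi>) \<longleftrightarrow> antecedent_of \<sigma> xs \<and> pco_of \<sigma> \<phi>"

primrec pco_sat :: "('v, 'a) signature \<Rightarrow> ('v, 'a) cmteam \<Rightarrow> ('v, 'a) pco \<Rightarrow> bool" where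
  "pco_sat \<sigma> T (PEq Y y) \<longleftrightarrow> (\<forall>s \<in># fst T. s Y = y)"
| "pco_sat \<sigma> T (PNeq Y y) \<longleftrightarrow> (\<forall>s \<in># fst T. s Y \<noteq> y)"
| "pco_sat \<sigma> T (PrGeConst \<alpha> \<epsilon>) \<longleftrightarrow> fst T = {#} \<or> Prob \<sigma> T \<alpha> \<ge> \<epsilon>"
| "pco_sat \<sigma> T (PrGtConst \<alpha> \<epsilon>) \<longleftrightarrow> fst T = {#} \<or> Prob \<sigma> T \<alpha> > \<epsilon>"
| "pco_sat \<sigma> T (PrGe \<alpha> \<beta>) \<longleftrightarrow> fst T = {#} \<or> Prob \<sigma> T \<alpha> \<ge> Prob \<sigma> T \<beta>"
| "pco_sat \<sigma> T (PrGt \<alpha> \<beta>) \<longleftrightarrow> fst T = {#} \<or> Prob \<sigma> T \<alpha> > Prob \<sigma> T \<beta>"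
| "pco_sat \<sigma> T (PAnd \<phi> \<psi>) \<longleftrightarrow> pco_sat \<sigma> T \<phi> \<and> pco_sat \<sigma> T \<psi>"
| "pco_sat \<sigma> T (PGOr \<phi> \<psi>) \<longleftrightarrow> pco_sat \<sigma> T \<phi> \<or> pco_sat \<sigma> T \<psi>"
| "pco_sat \<sigma> T (PSel \<alpha> \<phi>) \<longleftrightarrow> pco_sat \<sigma> (observe \<sigma> T \<alpha>) \<phi>"
| "pco_sat \<sigma> T (PCf xs \<phi>) \<longleftrightarrow> (consistent xs \<longrightarrow> pco_sat \<sigma> (intervene \<sigma> xs T) \<phi>)"

text \<open>\<open>R\<close> is the comparison \<open>\<lhd>\<close> of the atom \<open>Pr(\<alpha> | \<beta>) \<lhd> Pr(\<gamma> | \<delta>)\<close>.\<close>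

definition cond_cond_sat ::
  "(rat \<Rightarrow> rat \<Rightarrow> bool) \<Rightarrow> ('v, 'a) co \<Rightarrow> ('v, 'a) co \<Rightarrow> ('v, 'a) co \<Rightarrow> ('v, 'a) co \<Rightarrow>
   ('v, 'a) signature \<Rightarrow> ('v, 'a) cmteam \<Rightarrow> bool" where
  "cond_cond_sat R \<alpha> \<beta> \<gamma> \<delta> \<sigma> T \<longleftrightarrow>
     fst (observe \<sigma> T \<beta>) = {#} \<or> fst (observe \<sigma> T \<delta>) = {#} \<or>
     R (Prob \<sigma> (observe \<sigma> T \<beta>) \<alpha>) (Prob \<sigma> (observe \<sigma> T \<delta>) \<gamma>)"

definition cond_marg_sat ::
  "(rat \<Rightarrow> rat \<Rightarrow> bool) \<Rightarrow> ('v, 'a) co \<Rightarrow> ('v, 'a) co \<Rightarrow> ('v, 'a) co \<Rightarrow>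
   ('v, 'a) signature \<Rightarrow> ('v, 'a) cmteam \<Rightarrow> bool" where
  "cond_marg_sat R \<alpha> \<beta> \<gamma> \<sigma> T \<longleftrightarrow> cond_cond_sat R \<alpha> \<beta> \<gamma> (co_top \<sigma>) \<sigma> T"

definition expressible_in_PCO ::
  "('v, 'a) signature \<Rightarrow> (('v, 'a) signature \<Rightarrow> ('v, 'a) cmteam \<Rightarrow> bool) \<Rightarrow> bool" where
  "expressible_in_PCO \<sigma> A \<longleftrightarrow>
     (\<exists>\<phi>. pco_of \<sigma> \<phi> \<and> (\<forall>T. causal_multiteam \<sigma> T \<longrightarrow> (pco_sat \<sigma> T \<phi> \<longleftrightarrow> A \<sigma> T)))"

lemma co_top_of: "is_signature \<sigma> \<Longrightarrow> co_of \<sigma> (co_top \<sigma>)"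
  by (simp add: co_top_def is_signature_def Let_def some_in_eq)

lemma observe_co_top: "observe \<sigma> T (co_top \<sigma>) = T"
proof -
  have *: "co_sat \<sigma> ({#s#}, F) (COr (CEq X x) (CNeq X x))" for s F X x
  proof (cases "s X = x")
    case True
    then show ?thesis
      unfolding co_sat.simps by (intro exI[of _ "{#s#}"] exI[of _ "{#}"]) simp
  next
    case False
    then show ?thesis
      unfolding co_sat.simps by (intro exI[of _ "{#}"] exI[of _ "{#s#}"]) simp
  qed
  show ?thesis
    by (cases T) (simp add: observe_def co_top_def Let_def * del: co_sat.simps)
qed

lemma agree_on_parents:
  assumes fin: "finite (vars \<sigma>)"
    and w: "w \<in> other_assignments \<sigma> V" and w': "w' \<in> other_assignments \<sigma> V"
    and agree: "\<And>X. X \<in> parents \<sigma> V f \<Longrightarrow> w X = w' X"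
  shows "f w = f w'"
proof -
  have main: "D \<subseteq> vars \<sigma> - {V} \<Longrightarrow>
      (\<lambda>X. if X \<in> D then w' X else w X) \<in> other_assignments \<sigma> V \<and>
      f (\<lambda>X. if X \<in> D then w' X else w X) = f w" if "finite D" for D
    using that
  proof (induction D)
    case empty
    then show ?case using w by simp
  next
    case (insert Y D)
    let ?v = "\<lambda>X. if X \<in> D then w' X else w X"
    have eq: "(\<lambda>X. if X \<in> insert Y D then w' X else w X) = ?v(Y := w' Y)" by auto
    have Y: "Y \<in> vars \<sigma> - {V}" and IH: "?v \<in> other_assignments \<sigma> V" "f ?v = f w"
      using insert by auto
    have wY: "w' Y \<in> rng \<sigma> Y" using w' Y by (auto simp: other_assignments_def)
    have mem: "?v(Y := w' Y) \<in> other_assignments \<sigma> V"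
      using IH(1) Y wY by (auto simp: other_assignments_def PiE_iff extensional_def)
    have "f (?v(Y := w' Y)) = f ?v"
    proof (cases "Y \<in> parents \<sigma> V f")
      case True
      then have "?v(Y := w' Y) = ?v" using agree by auto
      then show ?thesis by simp
    next
      case False
      then show ?thesis using Y IH(1) wY unfolding parents_def by blast
    qed
    then show ?case using eq mem IH(2) by simp
  qed
  have "(\<lambda>X. if X \<in> vars \<sigma> - {V} then w' X else w X) = w'"
    using w w' by (auto simp: other_assignments_def PiE_iff extensional_def)
  then show ?thesis using main[of "vars \<sigma> - {V}"] fin by simp
qed

lemma do_solution_ex1:
  assumes sg: "is_signature \<sigma>" and F: "function_component \<sigma> F"
    and xs: "antecedent_of \<sigma> xs" and s: "s \<in> assignments \<sigma>"
  shows "\<exists>!s'. is_do_solution \<sigma> F xs s s'"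
proof -
  let ?G = "causal_graph \<sigma> F"
  have fin: "finite (vars \<sigma>)" using sg by (simp add: is_signature_def)
  have domF: "V \<in> vars \<sigma>" if "F V = Some f" for V f
    using F that by (auto simp: function_component_def)
  have Fran: "f w \<in> rng \<sigma> V" if "F V = Some f" "w \<in> other_assignments \<sigma> V" for V f w
    using F that unfolding function_component_def by blast
  have "?G \<subseteq> vars \<sigma> \<times> vars \<sigma>" using domF by (auto simp: causal_graph_def parents_def)
  then have "finite ?G" using fin finite_subset by blast
  then have wf: "wf ?G" using F finite_acyclic_wf by (auto simp: function_component_def)
  have rst: "restrict t (vars \<sigma> - {V}) \<in> other_assignments \<sigma> V" if "t \<in> assignments \<sigma>" for t V
    using that by (auto simp: assignments_def other_assignments_def)
  have xsr: "x \<in> rng \<sigma> V" if "map_of xs V = Some x" for V x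
    using xs map_of_SomeD[OF that] by (auto simp: antecedent_of_def)
  define H where "H = (\<lambda>h V. if V \<notin> vars \<sigma> then undefined else
     (case map_of xs V of Some x \<Rightarrow> x | None \<Rightarrow> (case F V of None \<Rightarrow> s V | Some f \<Rightarrow>
        f (\<lambda>X. if X \<in> vars \<sigma> - {V} then (if X \<in> parents \<sigma> V f then h X else s X) else undefined))))"
  define g where "g = wfrec ?G H"
  have g: "g V = H g V" for V
  proof -
    have "g V = H (cut g ?G V) V" unfolding g_def by (rule wfrec[OF wf])
    also have "\<dots> = H g V"
    proof (cases "F V")
      case None
      then show ?thesis by (simp add: H_def split: option.split)
    next
      case (Some f)
      then have "(X, V) \<in> ?G" if "X \<in> parents \<sigma> V f" for X
        using that by (simp add: causal_graph_def)
      then have "(\<lambda>X. if X \<in> vars \<sigma> - {V} then (if X \<in> parents \<sigma> V f then cut g ?G V X else s X) else undefined)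
         = (\<lambda>X. if X \<in> vars \<sigma> - {V} then (if X \<in> parents \<sigma> V f then g X else s X) else undefined)"
        by (auto simp: cut_def)
      then show ?thesis by (simp only: H_def Some option.case)
    qed
    finally show ?thesis .
  qed
  have g_out: "g V = undefined" if "V \<notin> vars \<sigma>" for V
    using that by (subst g) (simp add: H_def)
  have g_do: "g V = x" if "V \<in> vars \<sigma>" "map_of xs V = Some x" for V x
    using that by (subst g) (simp add: H_def)
  have g_exo: "g V = s V" if "V \<in> vars \<sigma>" "map_of xs V = None" "F V = None" for V
    using that by (subst g) (simp add: H_def)
  have g_end: "g V = f (\<lambda>X. if X \<in> vars \<sigma> - {V} then (if X \<in> parents \<sigma> V f then g X else s X) else undefined)"
    if "V \<in> vars \<sigma>" "map_of xs V = None" "F V = Some f" for V f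
    using that by (subst g) (simp add: H_def)
  have grng: "V \<in> vars \<sigma> \<Longrightarrow> g V \<in> rng \<sigma> V" for V
    using wf
  proof (induction V rule: wf_induct_rule)
    case (less V)
    have sV: "s X \<in> rng \<sigma> X" if "X \<in> vars \<sigma>" for X using s that by (auto simp: assignments_def)
    have "(\<lambda>X. if X \<in> vars \<sigma> - {V} then (if X \<in> parents \<sigma> V f then g X else s X) else undefined)
        \<in> other_assignments \<sigma> V" if "F V = Some f" for f
      using less.IH that sV by (auto simp: other_assignments_def PiE_iff extensional_def causal_graph_def)
    then have "f (\<lambda>X. if X \<in> vars \<sigma> - {V} then (if X \<in> parents \<sigma> V f then g X else s X) else undefined)
        \<in> rng \<sigma> V" if "F V = Some f" for f
      using that Fran by blast
    then show ?case
      using less.prems sV[of V] xsr[of V] g_do[of V] g_exo[of V] g_end[of V]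
      by (cases "map_of xs V"; cases "F V") simp_all
  qed
  have gA: "g \<in> assignments \<sigma>"
    using grng g_out by (auto simp: assignments_def PiE_iff extensional_def)
  have par: "f (\<lambda>X. if X \<in> vars \<sigma> - {V} then (if X \<in> parents \<sigma> V f then g X else s X) else undefined)
      = f (restrict g (vars \<sigma> - {V}))" for V f
    by (rule agree_on_parents[OF fin, of _ V])
      (use gA s in \<open>auto simp: other_assignments_def assignments_def PiE_iff extensional_def parents_def\<close>)
  have sol: "is_do_solution \<sigma> F xs s g"
    unfolding is_do_solution_def
  proof (intro conjI gA ballI)
    fix V assume "V \<in> vars \<sigma>"
    then show "g V = (case map_of xs V of Some x \<Rightarrow> x | None \<Rightarrow> (case F V of None \<Rightarrow> s V
        | Some f \<Rightarrow> f (restrict g (vars \<sigma> - {V}))))"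
      by (auto simp: g_do g_exo g_end par[symmetric] split: option.split)
  qed
  show ?thesis
  proof (rule ex1I[where a = g], rule sol)
    fix t assume t: "is_do_solution \<sigma> F xs s t"
    then have tA: "t \<in> assignments \<sigma>" by (simp add: is_do_solution_def)
    have "V \<in> vars \<sigma> \<Longrightarrow> t V = g V" for V
      using wf
    proof (induction V rule: wf_induct_rule)
      case (less V)
      have "f (restrict t (vars \<sigma> - {V})) = f (restrict g (vars \<sigma> - {V}))" if "F V = Some f" for f
        by (rule agree_on_parents[OF fin rst[OF tA] rst[OF gA]])
          (use less.IH that in \<open>auto simp: causal_graph_def parents_def\<close>)
      then show ?case
        using t sol less.prems unfolding is_do_solution_def by (auto split: option.split)
    qed
    then show "t = g"
      using tA gA by (auto simp: assignments_def intro: PiE_ext)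
  qed
qed

end

theory Submission
  imports Defs
begin

text \<open>Every \<open>PCO\<close> formula only tests signs of linear forms in the multiplicities of the
  assignments, whereas \<open>Pr(\<alpha> | \<beta>) \<lhd> Pr(\<beta>)\<close> compares the quadratic quantities
  \<open>|\<alpha> \<and> \<beta>| \<cdot> |T|\<close> and \<open>|\<beta>|\<^sup>2\<close>. Take one variable with values \<open>0, 1, 2\<close>, let \<open>\<alpha>\<close> be \<open>X = 0\<close>, let
  \<open>\<beta>\<close> be \<open>X \<noteq> 2\<close>, and consider multiteams with \<open>|\<alpha> \<and> \<beta>| = 1\<close>, \<open>|\<beta>| = t\<close> and \<open>|T| = t\<^sup>2 + e\<close> for
  \<open>e \<in> {-1, 0, 1}\<close>. The sign of the conditional comparison is that of \<open>e\<close>, but for large \<open>t\<close> the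
  sign of a linear form does not depend on \<open>e\<close>: either \<open>t\<^sup>2\<close> dominates, or \<open>|T|\<close> does not occur.\<close>

text \<open>Quantifying over all weights makes this relation closed under filtering and under images,
  which is what selective implications and counterfactuals do to a multiteam.\<close>

definition linearly_similar :: "(nat \<Rightarrow> 's multiset) \<Rightarrow> (nat \<Rightarrow> 's multiset) \<Rightarrow> bool" where
  "linearly_similar M M' \<longleftrightarrow> (\<forall>w :: 's \<Rightarrow> rat.
     \<forall>\<^sub>F n in sequentially. sgn (\<Sum>s\<in>#M n. w s) = sgn (\<Sum>s\<in>#M' n. w s))"

lemma linearly_similarD:
  "linearly_similar M M' \<Longrightarrow>
     \<forall>\<^sub>F n in sequentially. sgn (\<Sum>s\<in>#M n. w s) = sgn (\<Sum>s\<in>#M' n. (w s :: rat))"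
  by (simp add: linearly_similar_def)

lemma sum_mset_filter: "(\<Sum>s\<in>#filter_mset P M. w s) = (\<Sum>s\<in>#M. if P s then w s else 0)"
  by (induction M) auto

text \<open>Filtering only replaces the weight by one that vanishes outside \<open>P\<close>, and
  such weights are already among those quantified over. For images the weight \<open>w\<close> is
  pulled back to \<open>w \<circ> f\<close>.\<close>

lemma linearly_similar_filter:
  assumes "linearly_similar M M'"
  shows "linearly_similar (\<lambda>n. filter_mset P (M n)) (\<lambda>n. filter_mset P (M' n))"
  using assms by (simp add: linearly_similar_def sum_mset_filter)

lemma linearly_similar_image:
  assumes "linearly_similar M M'"
  shows "linearly_similar (\<lambda>n. image_mset f (M n)) (\<lambda>n. image_mset f (M' n))"
  using linearly_similarD[OF assms, of "w \<circ> f" for w]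
  by (simp add: linearly_similar_def multiset.map_comp comp_def)

lemma sum_mset_size_filter:
  "(\<Sum>s\<in>#M. (of_bool (P s) - c * of_bool (Q s) :: rat)) =
     of_nat (size (filter_mset P M)) - c * of_nat (size (filter_mset Q M))"
  by (induction M) (auto simp: algebra_simps)

text \<open>The weight \<open>of_bool (P s) - c * of_bool (Q s)\<close> turns a comparison of counts
  into a linear form. Threshold atoms use c = \<epsilon> with \<open>Q\<close> always true;
  comparisons of two probabilities use c = 1.\<close>

lemma linearly_similar_sizes:
  assumes "linearly_similar M M'"
  shows "\<forall>\<^sub>F n in sequentially.
     sgn (of_nat (size (filter_mset P (M n))) - c * of_nat (size (filter_mset Q (M n))) :: rat) =
     sgn (of_nat (size (filter_mset P (M' n))) - c * of_nat (size (filter_mset Q (M' n))))"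
  using linearly_similarD[OF assms, of "\<lambda>s. of_bool (P s) - c * of_bool (Q s)"]
  by (simp only: sum_mset_size_filter)

lemma le_iff_sgn_diff: "b \<le> a \<longleftrightarrow> sgn (a - b) \<noteq> -1" for a b :: "'a :: linordered_idom"
  by (simp add: sgn_if)

lemma less_iff_sgn_diff: "b < a \<longleftrightarrow> sgn (a - b) = 1" for a b :: "'a :: linordered_idom"
  by (simp add: sgn_if)

lemma linearly_similar_le:
  assumes "linearly_similar M M'"
  shows "\<forall>\<^sub>F n in sequentially.
     c * of_nat (size (filter_mset Q (M n))) \<le> (of_nat (size (filter_mset P (M n))) :: rat) \<longleftrightarrow>
     c * of_nat (size (filter_mset Q (M' n))) \<le> (of_nat (size (filter_mset P (M' n))) :: rat)"
  unfolding le_iff_sgn_diff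
  using linearly_similar_sizes[OF assms, of P c Q] by (rule eventually_mono) (simp only:)

lemma linearly_similar_less:
  assumes "linearly_similar M M'"
  shows "\<forall>\<^sub>F n in sequentially.
     c * of_nat (size (filter_mset Q (M n))) < (of_nat (size (filter_mset P (M n))) :: rat) \<longleftrightarrow>
     c * of_nat (size (filter_mset Q (M' n))) < (of_nat (size (filter_mset P (M' n))) :: rat)"
  unfolding less_iff_sgn_diff
  using linearly_similar_sizes[OF assms, of P c Q] by (rule eventually_mono) (simp only:)

lemma linearly_similar_Ball:
  assumes "linearly_similar M M'"
  shows "\<forall>\<^sub>F n in sequentially. (\<forall>s\<in>#M n. P s) \<longleftrightarrow> (\<forall>s\<in>#M' n. P s)"
proof -
  \<comment> \<open>With c = 0 the form counts the violators of \<open>P\<close>, so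
    \<open>Q\<close> is arbitrary.\<close>
  have *: "0 * of_nat (size (filter_mset Q A)) < (of_nat (size {#s \<in># A. \<not> P s#}) :: rat) \<longleftrightarrow>
      \<not> (\<forall>s\<in>#A. P s)" for A Q
    by (auto simp: nonempty_has_size[symmetric])
  show ?thesis
    using linearly_similar_less[OF assms, of 0 "\<lambda>_. True" "\<lambda>s. \<not> P s", unfolded *]
    by (rule eventually_mono) blast
qed

lemma linearly_similar_empty:
  assumes "linearly_similar M M'"
  shows "\<forall>\<^sub>F n in sequentially. M n = {#} \<longleftrightarrow> M' n = {#}"
  using linearly_similar_Ball[OF assms, of "\<lambda>_. False"]
  by simp

lemma size_pos: "A \<noteq> {#} \<Longrightarrow> (0 :: rat) < of_nat (size A)"
  by (simp add: nonempty_has_size)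

text \<open>Truth of a CO formula at a singleton depends on \<open>s\<close> and \<open>F\<close>
  alone. As \<open>F\<close> is shared, both sequences are filtered by the same predicate and mapped
  by the same \<open>do_assignment\<close>, so similarity survives. Selection changes the multisets
  and interventions also change \<open>F\<close>, hence the generalisation. The threshold for
  \<open>n\<close> may depend on \<phi>; binary connectives intersect two tails.\<close>

lemma pco_sat_linearly_similar:
  "linearly_similar M M' \<Longrightarrow>
     \<forall>\<^sub>F n in sequentially. pco_sat \<sigma> (M n, F) \<phi> \<longleftrightarrow> pco_sat \<sigma> (M' n, F) \<phi>"
proof (induction \<phi> arbitrary: M M' F)
  case (PEq Y y)
  then show ?case using linearly_similar_Ball by simp
next
  case (PNeq Y y)
  then show ?case using linearly_similar_Ball by simp
next
  case (PrGeConst \<alpha> \<epsilon>)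
  let ?P = "\<lambda>s. co_sat \<sigma> ({#s#}, F) \<alpha>" and ?Q = "\<lambda>s. True"
  \<comment> \<open>On nonempty \<open>A\<close> the positive denominator, counted by
    \<open>?Q\<close>, is cleared.\<close>
  have *: "pco_sat \<sigma> (A, F) (PrGeConst \<alpha> \<epsilon>) \<longleftrightarrow> A = {#} \<or>
      \<epsilon> * of_nat (size (filter_mset ?Q A)) \<le> (of_nat (size (filter_mset ?P A)) :: rat)" for A
    by (cases "A = {#}") (simp_all add: Prob_def observe_def pos_le_divide_eq[OF size_pos])
  show ?case
    unfolding *
    using linearly_similar_empty[OF PrGeConst] linearly_similar_le[OF PrGeConst, of \<epsilon> ?Q ?P]
    by (rule eventually_elim2) blast
next
  case (PrGtConst \<alpha> \<epsilon>)
  let ?P = "\<lambda>s. co_sat \<sigma> ({#s#}, F) \<alpha>" and ?Q = "\<lambda>s. True"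
  have *: "pco_sat \<sigma> (A, F) (PrGtConst \<alpha> \<epsilon>) \<longleftrightarrow> A = {#} \<or>
      \<epsilon> * of_nat (size (filter_mset ?Q A)) < (of_nat (size (filter_mset ?P A)) :: rat)" for A
    by (cases "A = {#}") (simp_all add: Prob_def observe_def pos_less_divide_eq[OF size_pos])
  show ?case
    unfolding *
    using linearly_similar_empty[OF PrGtConst] linearly_similar_less[OF PrGtConst, of \<epsilon> ?Q ?P]
    by (rule eventually_elim2) blast
next
  case (PrGe \<alpha> \<beta>)
  let ?P = "\<lambda>s. co_sat \<sigma> ({#s#}, F) \<alpha>" and ?Q = "\<lambda>s. co_sat \<sigma> ({#s#}, F) \<beta>"
  \<comment> \<open>Both probabilities have the same denominator, which cancels.\<close>
  have *: "pco_sat \<sigma> (A, F) (PrGe \<alpha> \<beta>) \<longleftrightarrow> A = {#} \<or>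
      1 * of_nat (size (filter_mset ?Q A)) \<le> (of_nat (size (filter_mset ?P A)) :: rat)" for A
    by (cases "A = {#}") (simp_all add: Prob_def observe_def divide_le_cancel nonempty_has_size)
  show ?case
    unfolding *
    using linearly_similar_empty[OF PrGe] linearly_similar_le[OF PrGe, of 1 ?Q ?P]
    by (rule eventually_elim2) blast
next
  case (PrGt \<alpha> \<beta>)
  let ?P = "\<lambda>s. co_sat \<sigma> ({#s#}, F) \<alpha>" and ?Q = "\<lambda>s. co_sat \<sigma> ({#s#}, F) \<beta>"
  have *: "pco_sat \<sigma> (A, F) (PrGt \<alpha> \<beta>) \<longleftrightarrow> A = {#} \<or>
      1 * of_nat (size (filter_mset ?Q A)) < (of_nat (size (filter_mset ?P A)) :: rat)" for A
    by (cases "A = {#}") (simp_all add: Prob_def observe_def divide_less_cancel nonempty_has_size)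
  show ?case
    unfolding *
    using linearly_similar_empty[OF PrGt] linearly_similar_less[OF PrGt, of 1 ?Q ?P]
    by (rule eventually_elim2) blast
next
  case (PAnd \<phi> \<psi>)
  show ?case
    using PAnd.IH[OF PAnd.prems, of F] by (rule eventually_elim2) simp
next
  case (PGOr \<phi> \<psi>)
  show ?case
    using PGOr.IH[OF PGOr.prems, of F] by (rule eventually_elim2) simp
next
  case (PSel \<alpha> \<phi>)
  then show ?case by (simp add: observe_def linearly_similar_filter)
next
  case (PCf xs \<phi>)
  show ?case
    using PCf.IH[OF linearly_similar_image[OF PCf.prems], of "do_assignment \<sigma> F xs" "F |` (- fst ` set xs)"]
    by (rule eventually_mono) (simp add: intervene_def)
qed

lemma filter_replicate_mset:
  "filter_mset P (replicate_mset n s) = (if P s then replicate_mset n s else {#})"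
  by (induction n) auto

definition three_valued :: "(nat, nat) signature" where
  "three_valued = \<lparr>vars = {0}, rng = (\<lambda>_. {0, 1, 2})\<rparr>"

definition const_asg :: "nat \<Rightarrow> nat \<Rightarrow> nat" where
  "const_asg i = (\<lambda>_\<in>{0}. i)"

text \<open>With \<open>t = n + 2\<close> and \<open>k = t\<^sup>2 + e - t\<close> this is the multiteam described above.\<close>

definition team :: "nat \<Rightarrow> nat \<Rightarrow> (nat \<Rightarrow> nat) multiset" where
  "team n k = add_mset (const_asg 0)
     (replicate_mset (n + 1) (const_asg 1) + replicate_mset k (const_asg 2))"

lemma sgn_add_dominated: "\<bar>u\<bar> < \<bar>v\<bar> \<Longrightarrow> sgn (u + v) = sgn v" for u v :: "'a :: linordered_idom"
  by (auto simp: sgn_if abs_if split: if_splits)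

lemma sum_mset_team: "(\<Sum>s\<in>#team n k. w s) =
    (w (const_asg 0) + w (const_asg 1) * (of_nat n + 1) + w (const_asg 2) * of_nat k :: rat)"
  by (simp add: team_def algebra_simps)

lemma linearly_similar_team:
  assumes k: "\<And>n. n * (n + 1) \<le> k n" and l: "\<And>n. n * (n + 1) \<le> l n"
  shows "linearly_similar (\<lambda>n. team n (k n)) (\<lambda>n. team n (l n))"
  unfolding linearly_similar_def
proof
  fix w :: "(nat \<Rightarrow> nat) \<Rightarrow> rat"
  let ?x = "w (const_asg 0)" and ?y = "w (const_asg 1)" and ?z = "w (const_asg 2)"
  show "\<forall>\<^sub>F n in sequentially. sgn (\<Sum>s\<in>#team n (k n). w s) = sgn (\<Sum>s\<in>#team n (l n). w s)"
  proof (cases "?z = 0")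
    case True
    then show ?thesis by (simp add: sum_mset_team)
  next
    case False
    \<comment> \<open>Beyond \<open>N\<close>, |x| + |y| < |z| n. Multiplying by n + 1 bounds the
      other two terms strictly by |z| n (n + 1), which is where the quadratic lower bound on
      \<open>k\<close> and \<open>l\<close> comes from.\<close>
    obtain N where N: "(\<bar>?x\<bar> + \<bar>?y\<bar>) / \<bar>?z\<bar> < of_nat N" using reals_Archimedean2 by blast
    have dom: "sgn (\<Sum>s\<in>#team n j. w s) = sgn ?z" if "N \<le> n" and j: "n * (n + 1) \<le> j" for n j
    proof -
      have "(\<bar>?x\<bar> + \<bar>?y\<bar>) / \<bar>?z\<bar> < of_nat n" using N \<open>N \<le> n\<close> by (simp add: less_le_trans)
      then have n: "\<bar>?x\<bar> + \<bar>?y\<bar> < \<bar>?z\<bar> * of_nat n"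
        using False by (simp add: pos_divide_less_eq mult.commute)
      have "\<bar>?x + ?y * (of_nat n + 1)\<bar> \<le> \<bar>?x\<bar> + \<bar>?y\<bar> * (of_nat n + 1)"
        by (rule order_trans[OF abs_triangle_ineq]) (simp add: abs_mult)
      also have "\<dots> \<le> (\<bar>?x\<bar> + \<bar>?y\<bar>) * (of_nat n + 1)"
        by (simp add: algebra_simps)
      also have "\<dots> < \<bar>?z\<bar> * of_nat n * (of_nat n + 1)"
        using n by (rule mult_strict_right_mono) (simp add: add_nonneg_pos)
      also have "\<dots> = \<bar>?z\<bar> * of_nat (n * (n + 1))" by (simp add: algebra_simps)
      also have "\<dots> \<le> \<bar>?z\<bar> * of_nat j" using j by (intro mult_left_mono) (simp_all only: of_nat_le_iff abs_ge_zero)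
      finally have "\<bar>?x + ?y * (of_nat n + 1)\<bar> < \<bar>?z * of_nat j\<bar>" by (simp add: abs_mult)
      then have "sgn (\<Sum>s\<in>#team n j. w s) = sgn (?z * of_nat j)"
        unfolding sum_mset_team by (rule sgn_add_dominated)
      moreover have "j \<noteq> 0" using \<open>\<bar>?x + _\<bar> < \<bar>?z * of_nat j\<bar>\<close> by (intro notI) simp
      ultimately show ?thesis by (simp add: sgn_mult)
    qed
    show ?thesis
      using eventually_ge_at_top[of N] by (rule eventually_mono) (simp only: dom k l)
  qed
qed

lemma is_signature_three_valued: "is_signature three_valued"
  by (simp add: is_signature_def three_valued_def)

lemma causal_multiteam_team: "causal_multiteam three_valued (team n k, Map.empty)"
  by (auto simp: causal_multiteam_def team_def three_valued_def assignments_def const_asg_def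
      function_component_def compatible_def causal_graph_def acyclic_def)

text \<open>The single copy of \<open>const_asg 0\<close> satisfies the condition, so neither
  vacuous case of the atom applies.\<close>

lemma cond_marg_sat_team:
  "cond_marg_sat R (CEq 0 0) (CNeq 0 2) (CNeq 0 2) three_valued (team n k, Map.empty) \<longleftrightarrow>
     R (1 / (of_nat n + 2)) ((of_nat n + 2) / (of_nat n + 2 + of_nat k))"
  unfolding cond_marg_sat_def cond_cond_sat_def observe_co_top
  by (simp add: observe_def Prob_def team_def const_asg_def filter_replicate_mset algebra_simps)

text \<open>Perturbing t * t in both directions is essential: \<le> and > separate the balanced case
  only from +1, \<ge> and < only from -1, and equality from both.\<close>

lemma cond_marg_not_expressible:
  assumes R: "R \<in> {(\<le>), (\<ge>), (<), (>), (=)}"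
  shows "\<not> expressible_in_PCO three_valued (cond_marg_sat R (CEq 0 0) (CNeq 0 2) (CNeq 0 2))"
proof
  assume "expressible_in_PCO three_valued (cond_marg_sat R (CEq 0 0) (CNeq 0 2) (CNeq 0 2))"
  then obtain \<phi> where \<phi>: "pco_sat three_valued (team n k, Map.empty) \<phi> \<longleftrightarrow>
      R (1 / (of_nat n + 2)) ((of_nat n + 2) / (of_nat n + 2 + of_nat k))" for n k
    using causal_multiteam_team cond_marg_sat_team unfolding expressible_in_PCO_def by metis
  \<comment> \<open>This is t * t - t for t = n + 2, and it is at least 2, so the natural
    subtraction in \<open>?k n - 1\<close> is exact.\<close>
  let ?k = "\<lambda>n. (n + 2) * (n + 1)"
  have bounds: "n * (n + 1) \<le> ?k n" "n * (n + 1) \<le> ?k n + 1" "n * (n + 1) \<le> ?k n - 1" for n :: nat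
    by (auto simp: algebra_simps)
  have "\<forall>\<^sub>F n in sequentially.
      (pco_sat three_valued (team n (?k n), Map.empty) \<phi> \<longleftrightarrow>
        pco_sat three_valued (team n (?k n + 1), Map.empty) \<phi>) \<and>
      (pco_sat three_valued (team n (?k n), Map.empty) \<phi> \<longleftrightarrow>
        pco_sat three_valued (team n (?k n - 1), Map.empty) \<phi>)"
    by (intro eventually_conj pco_sat_linearly_similar linearly_similar_team bounds)
  then obtain n where n:
      "pco_sat three_valued (team n (?k n), Map.empty) \<phi> \<longleftrightarrow>
        pco_sat three_valued (team n (?k n + 1), Map.empty) \<phi>"
      "pco_sat three_valued (team n (?k n), Map.empty) \<phi> \<longleftrightarrow>
        pco_sat three_valued (team n (?k n - 1), Map.empty) \<phi>"
    using eventually_happens by fastforce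
  define t :: rat where "t = of_nat n + 2"
  have t: "2 \<le> t" by (simp add: t_def)
  then have t2: "4 \<le> t * t" using mult_mono[of 2 t 2 t] by simp
  have k: "t + of_nat (?k n) = t * t" "t + of_nat (?k n + 1) = t * t + 1"
      "t + of_nat (?k n - 1) = t * t - 1"
    by (simp_all add: t_def algebra_simps of_nat_diff)
  have "R (1 / t) (t / (t * t)) = R (1 / t) (t / (t * t + 1))"
       "R (1 / t) (t / (t * t)) = R (1 / t) (t / (t * t - 1))"
    using n unfolding \<phi> t_def[symmetric] k by auto
  moreover have "t / (t * t) = 1 / t" "t / (t * t + 1) < 1 / t" "1 / t < t / (t * t - 1)"
    using t t2 by (simp_all add: field_simps add_pos_pos)
  ultimately show False using R by auto
qed

theorem theorem8:
  fixes R :: "rat \<Rightarrow> rat \<Rightarrow> bool"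
  assumes "R \<in> {(\<le>), (\<ge>), (<), (>), (=)}"
  shows "(\<exists>(\<sigma> :: (nat, nat) signature) \<alpha> \<beta> \<gamma> \<delta>.
            is_signature \<sigma> \<and> co_of \<sigma> \<alpha> \<and> co_of \<sigma> \<beta> \<and> co_of \<sigma> \<gamma> \<and> co_of \<sigma> \<delta> \<and>
            \<not> expressible_in_PCO \<sigma> (cond_cond_sat R \<alpha> \<beta> \<gamma> \<delta>)) \<and>
         (\<exists>(\<sigma> :: (nat, nat) signature) \<alpha> \<beta> \<gamma>.
            is_signature \<sigma> \<and> co_of \<sigma> \<alpha> \<and> co_of \<sigma> \<beta> \<and> co_of \<sigma> \<gamma> \<and>
            \<not> expressible_in_PCO \<sigma> (cond_marg_sat R \<alpha> \<beta> \<gamma>))"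
proof -
  let ?\<alpha> = "CEq 0 0 :: (nat, nat) co" and ?\<beta> = "CNeq 0 2 :: (nat, nat) co"
  have co: "co_of three_valued ?\<alpha>" "co_of three_valued ?\<beta>"
    by (simp_all add: three_valued_def)
  have marg: "\<not> expressible_in_PCO three_valued (cond_marg_sat R ?\<alpha> ?\<beta> ?\<beta>)"
    using assms by (rule cond_marg_not_expressible)
  then have "\<not> expressible_in_PCO three_valued (cond_cond_sat R ?\<alpha> ?\<beta> ?\<beta> (co_top three_valued))"
    by (simp add: expressible_in_PCO_def cond_marg_sat_def)
  then show ?thesis
    using marg co is_signature_three_valued co_top_of[OF is_signature_three_valued] by blast
qed

end
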